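(* Logical contractiveness is incomparable with the Meir--Keeler property and with asymptotic nonexpansiveness (all for self-maps of complete metric spaces): 1. There exists a logically contractive map that is not a Meir--Keeler contraction. 2. There exists a Meir--Keeler contraction that is not logically contractive. 3. There exists an asymptotically nonexpansive map that is not logically contractive. Moreover, under the Goebel--Kirk definition of asymptotic nonexpansiveness, every nonexpansive map (hence every logically contractive map) is trivially asymptotically nonexpansive, by taking $k_n\equiv 1$.
   Context: Throughout, $(X,d)$ is a complete metric space and maps are self-maps $T:X\to X$. For a positive integer $n$, $T^n$ denotes the $n$-fold composition (so $T^1=T$). For a self-map $S$ of $X$, $\mathrm{Lip}(S):=\sup_{x\ne y}\frac{d(Sx,Sy)}{d(x,y)}$. A map $T$ is nonexpansive if $\mathrm{Lip}(T)\le 1$. Two properties of maps are called incomparable if neither subsumes (is implied by) the other. Definitions, for $T:X\to X$: - $T$ is logically contractive if $T$ is nonexpansive and there exist a constant $\lambda\in(0,1)$ and an increasing sequence of natural numbers $n_1<n_2<n_3<\cdots$ such that $\mathrm{Lip}(T^{n_k})\le\lambda^k$ for all $k\ge 1$. - $T$ is a Meir--Keeler contraction if for every $\varepsilon>0$ there exists $\delta>0$ such that, for all $x,y\in X$, $d(x,y)\in[\varepsilon,\varepsilon+\delta)$ implies $d(Tx,Ty)<\varepsilon$. - $T$ is asymptotically nonexpansive (the Goebel--Kirk definition) if there exist real numbers $k_n\ge 1$ with $k_n\to 1$ such that $d(T^nx,T^ny)\le k_n\,d(x,y)$ for all $x,y\in X$ and all positive integers $n$.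
   Formalization: Incomparability with asymptotic nonexpansiveness is false as stated, since every logically contractive map is asymptotically nonexpansive (k_n ≡ 1); for that pair only item 3 and the "Moreover" implication are stated. *)

theory Defs
  imports "HOL-Analysis.Analysis"
begin

text \<open>Completeness is taken to be part of the ambient setting: a map of the
  theory is a self-map of a complete metric space, given as an element of the
  library type of metric spaces with an explicit carrier.\<close>

definition complete_self_map :: "'a metric \<Rightarrow> ('a \<Rightarrow> 'a) \<Rightarrow> bool" where
  "complete_self_map m T \<longleftrightarrow> mcomplete_of m \<and> T \<in> mspace m \<rightarrow> mspace m"

text \<open>Valued in \<^typ>\<open>ennreal\<close>, so that the supremum always exists (possibly
  infinite) and is \<open>0\<close> on spaces with at most one point.\<close>

definition Lip :: "'a metric \<Rightarrow> ('a \<Rightarrow> 'a) \<Rightarrow> ennreal" where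
  "Lip m S = (SUP (x, y) \<in> {(x, y). x \<in> mspace m \<and> y \<in> mspace m \<and> x \<noteq> y}.
                ennreal (mdist m (S x) (S y) / mdist m x y))"

definition nonexpansive :: "'a metric \<Rightarrow> ('a \<Rightarrow> 'a) \<Rightarrow> bool" where
  "nonexpansive m T \<longleftrightarrow> Lip m T \<le> 1"

text \<open>The sequence is indexed from \<open>1\<close>, so \<open>n 0\<close> is irrelevant; its members are
  positive because only positive powers of \<open>T\<close> are considered.\<close>

definition logically_contractive :: "'a metric \<Rightarrow> ('a \<Rightarrow> 'a) \<Rightarrow> bool" where
  "logically_contractive m T \<longleftrightarrow>
     nonexpansive m T \<and>
     (\<exists>l::real. 0 < l \<and> l < 1 \<and>
       (\<exists>n::nat \<Rightarrow> nat. 0 < n 1 \<and> strict_mono_on {1..} n \<and>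
         (\<forall>k\<ge>1. Lip m (T ^^ n k) \<le> ennreal (l ^ k))))"

definition Meir_Keeler :: "'a metric \<Rightarrow> ('a \<Rightarrow> 'a) \<Rightarrow> bool" where
  "Meir_Keeler m T \<longleftrightarrow>
     (\<forall>\<epsilon>>0. \<exists>\<delta>>0. \<forall>x\<in>mspace m. \<forall>y\<in>mspace m.
        mdist m x y \<in> {\<epsilon>..<\<epsilon> + \<delta>} \<longrightarrow> mdist m (T x) (T y) < \<epsilon>)"

definition asymptotically_nonexpansive_with ::
    "(nat \<Rightarrow> real) \<Rightarrow> 'a metric \<Rightarrow> ('a \<Rightarrow> 'a) \<Rightarrow> bool" where
  "asymptotically_nonexpansive_with k m T \<longleftrightarrow>
     (\<forall>n\<ge>1. 1 \<le> k n) \<and> k \<longlonglongrightarrow> 1 \<and>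
     (\<forall>n\<ge>1. \<forall>x\<in>mspace m. \<forall>y\<in>mspace m.
        mdist m ((T ^^ n) x) ((T ^^ n) y) \<le> k n * mdist m x y)"

definition asymptotically_nonexpansive :: "'a metric \<Rightarrow> ('a \<Rightarrow> 'a) \<Rightarrow> bool" where
  "asymptotically_nonexpansive m T \<longleftrightarrow> (\<exists>k. asymptotically_nonexpansive_with k m T)"

text \<open>The failures of the two implications are witnessed within one fixed point
  type, since HOL does not quantify over types inside a formula.\<close>

definition incomparable ::
    "('a metric \<Rightarrow> ('a \<Rightarrow> 'a) \<Rightarrow> bool) \<Rightarrow> ('a metric \<Rightarrow> ('a \<Rightarrow> 'a) \<Rightarrow> bool) \<Rightarrow> bool" where
  "incomparable P Q \<longleftrightarrow>
     \<not> (\<forall>m T. complete_self_map m T \<longrightarrow> P m T \<longrightarrow> Q m T) \<and>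
     \<not> (\<forall>m T. complete_self_map m T \<longrightarrow> Q m T \<longrightarrow> P m T)"

end

theory Submission
  imports Defs
begin

text \<open>
  Three self-maps of the real line separate the properties.

  A nilpotent map can keep one distance unchanged, which the Meir--Keeler property forbids, while
  some power of it is constant. The ramp \<open>x \<mapsto> max 0 (min 1 (x - 1))\<close> does this: it keeps the
  distance of \<open>1\<close> and \<open>2\<close>, and its square vanishes, so \<open>Lip (T\<^sup>n) = 0\<close> for \<open>n \<ge> 2\<close>.

  In the other direction, a logically contractive map has a power with Lipschitz constant below
  \<open>1\<close>. The Meir--Keeler property bounds distances only scale by scale and lets the contraction
  ratio tend to \<open>1\<close> as the distance tends to \<open>0\<close>. This occurs for \<open>T x = \<bar>x\<bar> / (1 + \<bar>x\<bar>)\<close>: it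
  satisfies \<open>\<bar>T x - T y\<bar> \<le> r / (1 + r)\<close> with \<open>r = \<bar>x - y\<bar>\<close>, but
  \<open>T\<^sup>n x = x / (1 + n x)\<close> for \<open>x \<ge> 0\<close> has derivative \<open>1\<close> at \<open>0\<close> for every \<open>n\<close>. Hence no power
  has a Lipschitz constant below \<open>1\<close>. The same obstruction applies to the identity, whose powers
  are trivially nonexpansive.

  Finally, the powers of a nonexpansive self-map are nonexpansive, which makes it
  asymptotically nonexpansive with all constants equal to \<open>1\<close>.
\<close>

lemma Lip_le_ennreal_iff:
  assumes "S \<in> mspace m \<rightarrow> mspace m" and "0 \<le> c"
  shows "Lip m S \<le> ennreal c \<longleftrightarrow>
    (\<forall>x\<in>mspace m. \<forall>y\<in>mspace m. mdist m (S x) (S y) \<le> c * mdist m x y)"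
proof -
  have ratio: "ennreal (mdist m (S x) (S y) / mdist m x y) \<le> ennreal c \<longleftrightarrow>
      mdist m (S x) (S y) \<le> c * mdist m x y"
    if "x \<in> mspace m" "y \<in> mspace m" "x \<noteq> y" for x y
  proof -
    have "0 < mdist m x y"
      using that by (metis mdist_nonneg mdist_zero order_le_less)
    then show ?thesis
      using assms(2) by (simp add: ennreal_le_iff pos_divide_le_eq)
  qed
  have diagonal: "mdist m (S x) (S x) \<le> c * mdist m x x" if "x \<in> mspace m" for x
  proof -
    have "mdist m (S x) (S x) = 0" "mdist m x x = 0"
      using assms(1) that by (subst mdist_zero; auto simp: Pi_iff)+
    then show ?thesis by simp
  qed
  show ?thesis
    unfolding Lip_def SUP_le_iff using ratio diagonal by fastforce
qed

lemma nonexpansive_iff: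
  assumes "T \<in> mspace m \<rightarrow> mspace m"
  shows "nonexpansive m T \<longleftrightarrow>
    (\<forall>x\<in>mspace m. \<forall>y\<in>mspace m. mdist m (T x) (T y) \<le> mdist m x y)"
  using Lip_le_ennreal_iff[OF assms, of 1] by (simp add: nonexpansive_def)

lemma nonexpansive_funpow:
  assumes "T \<in> mspace m \<rightarrow> mspace m" "nonexpansive m T" "x \<in> mspace m" "y \<in> mspace m"
  shows "mdist m ((T ^^ n) x) ((T ^^ n) y) \<le> mdist m x y"
proof (induction n)
  case (Suc n)
  have "(T ^^ n) z \<in> mspace m" if "z \<in> mspace m" for z
    using assms(1) that by (induction n) (auto simp: Pi_iff)
  then have "mdist m ((T ^^ Suc n) x) ((T ^^ Suc n) y) \<le> mdist m ((T ^^ n) x) ((T ^^ n) y)"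
    using assms by (simp add: nonexpansive_iff)
  with Suc.IH show ?case by linarith
qed simp

lemma nonexpansive_imp_asymptotically_nonexpansive_with_1:
  assumes "T \<in> mspace m \<rightarrow> mspace m" "nonexpansive m T"
  shows "asymptotically_nonexpansive_with (\<lambda>_. 1) m T"
  using nonexpansive_funpow[OF assms] by (simp add: asymptotically_nonexpansive_with_def)

lemma asymptotically_nonexpansive_if_nonexpansive:
  assumes "T \<in> mspace m \<rightarrow> mspace m" "nonexpansive m T"
  shows "asymptotically_nonexpansive m T"
  using nonexpansive_imp_asymptotically_nonexpansive_with_1[OF assms]
  by (auto simp: asymptotically_nonexpansive_def)

text \<open>The obstruction to logical contractiveness in both negative examples: already the first
  member of the sequence would be a power with Lipschitz constant at most \<open>\<lambda> < 1\<close>.\<close>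

lemma not_logically_contractive_if_Lip_funpow_ge_1:
  assumes "\<And>n. 0 < n \<Longrightarrow> 1 \<le> Lip m (T ^^ n)"
  shows "\<not> logically_contractive m T"
proof
  assume "logically_contractive m T"
  then obtain l n where l: "0 < l" "l < 1" and "0 < n 1"
    and "\<And>k. 1 \<le> k \<Longrightarrow> Lip m (T ^^ n k) \<le> ennreal (l ^ k)"
    unfolding logically_contractive_def by blast
  then have "1 \<le> ennreal l"
    using assms[of "n 1"] by (metis order.refl order.trans power_one_right)
  with l show False by simp
qed

lemma complete_self_map_real_line: "complete_self_map (euclidean_metric :: real metric) T"
  by (simp add: complete_self_map_def mcomplete_of_def complete_UNIV)


section \<open>A logically contractive map that keeps a distance\<close>

definition ramp :: "real \<Rightarrow> real" where
  "ramp x = max 0 (min 1 (x - 1))"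

lemma ramp_funpow_eq_0:
  assumes "2 \<le> n"
  shows "(ramp ^^ n) x = 0"
proof -
  have "(ramp ^^ (j + 2)) x = 0" for j
    by (induction j) (auto simp: ramp_def numeral_2_eq_2)
  then show ?thesis
    using assms by (metis le_add_diff_inverse2)
qed

lemma logically_contractive_ramp: "logically_contractive euclidean_metric ramp"
proof -
  have "nonexpansive euclidean_metric ramp"
    by (auto simp: nonexpansive_iff ramp_def dist_real_def)
  moreover have "Lip euclidean_metric (ramp ^^ Suc k) \<le> ennreal ((1/2) ^ k)" if "1 \<le> k" for k
    using that by (simp add: Lip_le_ennreal_iff ramp_funpow_eq_0 del: funpow.simps)
  moreover have "strict_mono_on {1..} Suc"
    by (simp add: strict_mono_on_def)
  ultimately show ?thesis
    unfolding logically_contractive_def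
    by (intro conjI exI[of _ "1/2"] exI[of _ Suc]) auto
qed

lemma not_Meir_Keeler_ramp: "\<not> Meir_Keeler euclidean_metric ramp"
proof
  assume "Meir_Keeler euclidean_metric ramp"
  then obtain \<delta> :: real where "0 < \<delta>"
    and "\<And>x y. dist x y \<in> {1..<1 + \<delta>} \<Longrightarrow> dist (ramp x) (ramp y) < 1"
    unfolding Meir_Keeler_def by (metis UNIV_I mdist_euclidean_metric mspace_euclidean_metric zero_less_one)
  then have "dist (ramp 1) (ramp 2) < 1"
    by (simp add: dist_real_def)
  then show False
    by (simp add: ramp_def dist_real_def)
qed


section \<open>A Meir--Keeler contraction all of whose powers have Lipschitz constant \<open>1\<close>\<close>

text \<open>The absolute values let the map of the half-line act on all of \<open>\<real>\<close> without increasing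
  distances.\<close>

definition damp :: "real \<Rightarrow> real" where
  "damp x = \<bar>x\<bar> / (1 + \<bar>x\<bar>)"

text \<open>On the half-line, \<open>damp u - damp v = (u - v) / ((1 + u) (1 + v))\<close>, and for \<open>u \<ge> v \<ge> 0\<close> the
  denominator is at least \<open>1 + (u - v)\<close>.\<close>

lemma damp_dist_le: "\<bar>damp x - damp y\<bar> \<le> \<bar>x - y\<bar> / (1 + \<bar>x - y\<bar>)"
proof -
  have half_line: "u / (1 + u) - v / (1 + v) \<le> (u - v) / (1 + (u - v))"
    if "0 \<le> v" "v \<le> u" for u v :: real
  proof -
    have "u / (1 + u) - v / (1 + v) = (u - v) / ((1 + u) * (1 + v))"
      using that by (simp add: field_simps)
    also have "\<dots> \<le> (u - v) / (1 + (u - v))"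
      using that by (intro divide_left_mono mult_pos_pos) (auto simp: algebra_simps)
    finally show ?thesis .
  qed
  have mono: "r / (1 + r) \<le> s / (1 + s)" if "0 \<le> r" "r \<le> s" for r s :: real
    using that by (simp add: field_simps)
  have ordered: "\<bar>damp a - damp b\<bar> \<le> \<bar>a - b\<bar> / (1 + \<bar>a - b\<bar>)" if "\<bar>b\<bar> \<le> \<bar>a\<bar>" for a b
  proof -
    have "\<bar>damp a - damp b\<bar> = damp a - damp b"
      using mono[of "\<bar>b\<bar>" "\<bar>a\<bar>"] that by (simp add: damp_def)
    also have "\<dots> \<le> (\<bar>a\<bar> - \<bar>b\<bar>) / (1 + (\<bar>a\<bar> - \<bar>b\<bar>))"
      using half_line[of "\<bar>b\<bar>" "\<bar>a\<bar>"] that by (simp add: damp_def)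
    also have "\<dots> \<le> \<bar>a - b\<bar> / (1 + \<bar>a - b\<bar>)"
      using that by (intro mono) auto
    finally show ?thesis .
  qed
  show ?thesis
    using ordered[of y x] ordered[of x y] by (cases "\<bar>y\<bar> \<le> \<bar>x\<bar>") (auto simp: abs_minus_commute)
qed

lemma Meir_Keeler_damp: "Meir_Keeler euclidean_metric damp"
  unfolding Meir_Keeler_def
proof (intro allI impI)
  fix \<epsilon> :: real
  assume "0 < \<epsilon>"
  have "dist (damp x) (damp y) < \<epsilon>" if "dist x y \<in> {\<epsilon>..<\<epsilon> + \<epsilon>\<^sup>2}" for x y
  proof -
    have r: "\<epsilon> \<le> \<bar>x - y\<bar>" "\<bar>x - y\<bar> < \<epsilon> + \<epsilon>\<^sup>2"
      using that by (auto simp: dist_real_def)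
    \<comment> \<open>For \<open>r \<ge> \<epsilon>\<close>, the bound \<open>r < \<epsilon> + \<epsilon>\<^sup>2\<close> gives \<open>r < \<epsilon> (1 + r)\<close>, that is \<open>r / (1 + r) < \<epsilon>\<close>.\<close>
    have "\<epsilon> * \<epsilon> \<le> \<epsilon> * \<bar>x - y\<bar>"
      using r(1) \<open>0 < \<epsilon>\<close> by (intro mult_left_mono) auto
    then have "\<bar>x - y\<bar> < \<epsilon> * (1 + \<bar>x - y\<bar>)"
      using r(2) unfolding power2_eq_square distrib_left by linarith
    then have "\<bar>x - y\<bar> / (1 + \<bar>x - y\<bar>) < \<epsilon>"
      by (subst pos_divide_less_eq) auto
    then show ?thesis
      using damp_dist_le[of x y] by (simp add: dist_real_def)
  qed
  with \<open>0 < \<epsilon>\<close> show "\<exists>\<delta>>0. \<forall>x\<in>mspace euclidean_metric. \<forall>y\<in>mspace euclidean_metric.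
      mdist euclidean_metric x y \<in> {\<epsilon>..<\<epsilon> + \<delta>} \<longrightarrow>
      mdist euclidean_metric (damp x) (damp y) < \<epsilon>"
    by (intro exI[of _ "\<epsilon>\<^sup>2"]) auto
qed

lemma damp_funpow:
  assumes "0 \<le> x"
  shows "(damp ^^ n) x = x / (1 + real n * x)"
proof (induction n)
  case (Suc n)
  have "damp (x / p) = x / (p + x)" if "0 < p" for p
  proof -
    have "damp (x / p) = (x / p) / ((p + x) / p)"
      using assms that by (simp add: damp_def add_divide_distrib)
    then show ?thesis
      using that by simp
  qed
  moreover have "0 < 1 + real n * x"
    using assms by (simp add: add_pos_nonneg)
  ultimately have "damp (x / (1 + real n * x)) = x / (1 + real n * x + x)"
    by blast
  with Suc.IH show ?case by (simp add: algebra_simps)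
qed simp

lemma Lip_damp_funpow_ge_1: "1 \<le> Lip euclidean_metric (damp ^^ n)"
proof (rule ccontr)
  assume "\<not> ?thesis"
  then have "Lip euclidean_metric (damp ^^ n) < 1" by simp
  then obtain c where c: "0 \<le> c" "c < 1" and "Lip euclidean_metric (damp ^^ n) = ennreal c"
    by (cases "Lip euclidean_metric (damp ^^ n)") auto
  then have "\<forall>x y. dist ((damp ^^ n) x) ((damp ^^ n) y) \<le> c * dist x y"
    using Lip_le_ennreal_iff[of "damp ^^ n" euclidean_metric c] by simp
  then have lipschitz: "dist ((damp ^^ n) x) ((damp ^^ n) 0) \<le> c * dist x 0" for x
    by blast
  have slope: "1 \<le> c * (1 + real n * x)" if "0 < x" for x
  proof -
    have "0 < 1 + real n * x"
      using that by (simp add: add_pos_nonneg)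
    moreover from this have "x / (1 + real n * x) \<le> c * x"
      using lipschitz[of x] that by (simp add: damp_funpow dist_real_def)
    ultimately show ?thesis
      using that by (simp add: pos_divide_le_eq)
  qed
  \<comment> \<open>The chord of \<open>damp ^^ n\<close> from \<open>0\<close> to \<open>x\<close> has slope \<open>1 / (1 + n x)\<close>, which tends to \<open>1\<close>
    as \<open>x\<close> decreases to \<open>0\<close>.\<close>
  have "((\<lambda>x. c * (1 + real n * x)) \<longlongrightarrow> c * (1 + real n * 0)) (at_right 0)"
    by (intro tendsto_intros)
  then have "1 \<le> c * (1 + real n * 0)"
    by (rule tendsto_lowerbound)
      (auto intro: eventually_mono[OF eventually_at_right_less[of 0]] slope)
  with c show False by simp
qed

lemma not_logically_contractive_damp: "\<not> logically_contractive euclidean_metric damp"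
  using Lip_damp_funpow_ge_1 by (rule not_logically_contractive_if_Lip_funpow_ge_1)


section \<open>The identity\<close>

lemma asymptotically_nonexpansive_id: "asymptotically_nonexpansive m (\<lambda>x. x)"
  by (rule asymptotically_nonexpansive_if_nonexpansive) (auto simp: nonexpansive_iff)

lemma not_logically_contractive_id:
  "\<not> logically_contractive (euclidean_metric :: real metric) (\<lambda>x. x)"
proof (rule not_logically_contractive_if_Lip_funpow_ge_1)
  fix n :: nat
  have "(\<lambda>x::real. x) ^^ n = (\<lambda>x. x)"
    by (induction n) (auto simp: fun_eq_iff)
  moreover have "1 \<le> Lip (euclidean_metric :: real metric) (\<lambda>x. x)"
    unfolding Lip_def by (rule SUP_upper2[of "(0, 1)"]) auto
  ultimately show "1 \<le> Lip (euclidean_metric :: real metric) ((\<lambda>x. x) ^^ n)" by simp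
qed


section \<open>Incomparability\<close>

theorem proposition3p1:
  shows "incomparable (logically_contractive :: real metric \<Rightarrow> (real \<Rightarrow> real) \<Rightarrow> bool) Meir_Keeler \<and>
    (\<exists>(m :: real metric) T. complete_self_map m T \<and>
       logically_contractive m T \<and> \<not> Meir_Keeler m T) \<and>
    (\<exists>(m :: real metric) T. complete_self_map m T \<and>
       Meir_Keeler m T \<and> \<not> logically_contractive m T) \<and>
    (\<exists>(m :: real metric) T. complete_self_map m T \<and>
       asymptotically_nonexpansive m T \<and> \<not> logically_contractive m T) \<and>
    (\<forall>(m :: 'a metric) T. complete_self_map m T \<longrightarrow> nonexpansive m T \<longrightarrow>
       asymptotically_nonexpansive_with (\<lambda>_. 1) m T \<and> asymptotically_nonexpansive m T) \<and>
    (\<forall>(m :: 'a metric) T. complete_self_map m T \<longrightarrow> logically_contractive m T \<longrightarrow>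
       asymptotically_nonexpansive m T)"
proof (intro conjI)
  show LC_not_MK: "\<exists>(m :: real metric) T. complete_self_map m T \<and>
      logically_contractive m T \<and> \<not> Meir_Keeler m T"
    using complete_self_map_real_line logically_contractive_ramp not_Meir_Keeler_ramp by blast
  show MK_not_LC: "\<exists>(m :: real metric) T. complete_self_map m T \<and>
      Meir_Keeler m T \<and> \<not> logically_contractive m T"
    using complete_self_map_real_line Meir_Keeler_damp not_logically_contractive_damp by blast
  show "incomparable (logically_contractive :: real metric \<Rightarrow> (real \<Rightarrow> real) \<Rightarrow> bool) Meir_Keeler"
    using LC_not_MK MK_not_LC unfolding incomparable_def by blast
  show "\<exists>(m :: real metric) T. complete_self_map m T \<and>
      asymptotically_nonexpansive m T \<and> \<not> logically_contractive m T"
    using complete_self_map_real_line asymptotically_nonexpansive_id not_logically_contractive_id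
    by blast
  show "\<forall>(m :: 'a metric) T. complete_self_map m T \<longrightarrow> nonexpansive m T \<longrightarrow>
      asymptotically_nonexpansive_with (\<lambda>_. 1) m T \<and> asymptotically_nonexpansive m T"
    by (simp add: complete_self_map_def nonexpansive_imp_asymptotically_nonexpansive_with_1
        asymptotically_nonexpansive_if_nonexpansive)
  show "\<forall>(m :: 'a metric) T. complete_self_map m T \<longrightarrow> logically_contractive m T \<longrightarrow>
      asymptotically_nonexpansive m T"
    by (simp add: complete_self_map_def logically_contractive_def
        asymptotically_nonexpansive_if_nonexpansive)
qed

end
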